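(* Let $S$ be a finite semigroup. The power graph $\mathrm{Pow}(S)$ is equal to the commuting graph $P_c(S)$ if and only if both of the following hold: (i) the order of every cyclic subgroup of $S$ is a prime power; (ii) every commutative subsemigroup of $S$ is monogenic.
   Context: Semigroups and subsemigroups are nonempty. $\mathbb{N}$ is the set of positive integers. For $a\in S$, $\langle a\rangle=\{a^k:k\in\mathbb{N}\}$. A semigroup is monogenic if it equals $\langle a\rangle$ for some element $a$ of it. A subgroup of $S$ is a subsemigroup of $S$ that is a group under the operation of $S$ (with its own identity element); a cyclic subgroup is a subgroup that is a cyclic group. A prime power is a number $p^n$ with $p$ prime and $n\geq 0$ an integer (so $1$ is allowed). Both graphs are simple graphs with vertex set $S$. In $\mathrm{Pow}(S)$, distinct $x,y$ are adjacent if and only if $x=y^k$ or $y=x^k$ for some $k\in\mathbb{N}$. In $P_c(S)$, distinct $x,y$ are adjacent if and only if $xy=yx$. Two graphs on $S$ are equal if they have the same edges. *)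

theory Defs
  imports
    "HOL-Algebra.Elementary_Groups"
    "HOL-Computational_Algebra.Primes"
    "Graph_Theory.Pair_Digraph"
begin

locale semigroup_on =
  fixes S :: "'a set" and mul :: "'a \<Rightarrow> 'a \<Rightarrow> 'a" (infixl \<open>\<cdot>\<close> 70)
  assumes nonempty: "S \<noteq> {}"
    and closed: "\<lbrakk>x \<in> S; y \<in> S\<rbrakk> \<Longrightarrow> x \<cdot> y \<in> S"
    and assoc: "\<lbrakk>x \<in> S; y \<in> S; z \<in> S\<rbrakk> \<Longrightarrow> (x \<cdot> y) \<cdot> z = x \<cdot> (y \<cdot> z)"

text \<open>A semigroup need not have an identity, so only exponents \<open>k \<ge> 1\<close> are meaningful:
  \<open>a\<^sup>1 = a\<close> and \<open>a\<^sup>k\<^sup>+\<^sup>1 = a \<cdot> a\<^sup>k\<close>. Every use below is restricted to \<open>k \<ge> 1\<close>.\<close>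

definition sg_pow :: "('a \<Rightarrow> 'a \<Rightarrow> 'a) \<Rightarrow> 'a \<Rightarrow> nat \<Rightarrow> 'a" where
  "sg_pow mul a k = (mul a ^^ (k - 1)) a"

definition monogenic :: "'a set \<Rightarrow> ('a \<Rightarrow> 'a \<Rightarrow> 'a) \<Rightarrow> bool" where
  "monogenic T mul \<longleftrightarrow> (\<exists>a\<in>T. T = {sg_pow mul a k | k. k \<ge> 1})"

definition subsemigroup :: "'a set \<Rightarrow> 'a set \<Rightarrow> ('a \<Rightarrow> 'a \<Rightarrow> 'a) \<Rightarrow> bool" where
  "subsemigroup T S mul \<longleftrightarrow> T \<subseteq> S \<and> semigroup_on T mul"

definition commutative_on :: "'a set \<Rightarrow> ('a \<Rightarrow> 'a \<Rightarrow> 'a) \<Rightarrow> bool" where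
  "commutative_on T mul \<longleftrightarrow> (\<forall>x\<in>T. \<forall>y\<in>T. mul x y = mul y x)"

text \<open>The identity element \<open>e\<close> of a subgroup of a semigroup is not prescribed: different
  subgroups may have different identities.\<close>

definition cyclic_subgroup :: "'a set \<Rightarrow> 'a set \<Rightarrow> ('a \<Rightarrow> 'a \<Rightarrow> 'a) \<Rightarrow> bool" where
  "cyclic_subgroup H S mul \<longleftrightarrow> subsemigroup H S mul \<and>
     (\<exists>e. group \<lparr>carrier = H, monoid.mult = mul, one = e\<rparr> \<and>
          cyclic_group \<lparr>carrier = H, monoid.mult = mul, one = e\<rparr>)"

text \<open>Unlike \<open>primepow\<close> of the library, this admits \<open>1 = p\<^sup>0\<close>.\<close>

definition prime_power :: "nat \<Rightarrow> bool" where
  "prime_power q \<longleftrightarrow> (\<exists>p n. prime p \<and> q = p ^ n)"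

text \<open>Simple graphs are represented as loop-free symmetric digraphs (\<open>pair_graph\<close>), each
  undirected edge being the pair of its two orientations.\<close>

definition power_graph :: "'a set \<Rightarrow> ('a \<Rightarrow> 'a \<Rightarrow> 'a) \<Rightarrow> 'a pair_pre_digraph" where
  "power_graph S mul =
     \<lparr>pverts = S,
      parcs = {(x, y). x \<in> S \<and> y \<in> S \<and> x \<noteq> y \<and>
                       (\<exists>k\<ge>1. x = sg_pow mul y k \<or> y = sg_pow mul x k)}\<rparr>"

definition commuting_graph :: "'a set \<Rightarrow> ('a \<Rightarrow> 'a \<Rightarrow> 'a) \<Rightarrow> 'a pair_pre_digraph" where
  "commuting_graph S mul =
     \<lparr>pverts = S,
      parcs = {(x, y). x \<in> S \<and> y \<in> S \<and> x \<noteq> y \<and> mul x y = mul y x}\<rparr>"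

lemma pair_graph_power_graph:
  assumes "finite S" shows "pair_graph (power_graph S mul)"
proof
  show "finite (parcs (power_graph S mul))"
    by (rule finite_subset[of _ "S \<times> S"]) (auto simp: power_graph_def assms)
qed (auto simp: power_graph_def assms symmetric_def arcs_ends_def arc_to_ends_def intro!: symI)

lemma pair_graph_commuting_graph:
  assumes "finite S" shows "pair_graph (commuting_graph S mul)"
proof
  show "finite (parcs (commuting_graph S mul))"
    by (rule finite_subset[of _ "S \<times> S"]) (auto simp: commuting_graph_def assms)
qed (auto simp: commuting_graph_def assms symmetric_def arcs_ends_def arc_to_ends_def intro!: symI)

end

theory Submission
  imports Defs "HOL-Algebra.Multiplicative_Group" "HOL-Number_Theory.Cong"
begin

text \<open>
  Write \<open>\<langle>a\<rangle>\<close> for the set of powers of \<open>a\<close>. Adjacency in the power graph always implies adjacency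
  in the commuting graph, so the graphs coincide if and only if of any two commuting elements
  one is a power of the other (\<open>graphs_equal_iff\<close>).

  Suppose that they coincide. If the order of a cyclic subgroup with generator \<open>g\<close> had
  two different prime divisors \<open>p\<close> and \<open>q\<close>, then neither of the commuting elements
  \<open>g\<^sup>p\<close>, \<open>g\<^sup>q\<close> could be a power of the other, because exponents are determined modulo the order
  and hence modulo \<open>p\<close> and modulo \<open>q\<close> (\<open>cyclic_subgroup_order\<close>). In a commutative
  subsemigroup \<open>T\<close>, the sets \<open>\<langle>a\<rangle>\<close> with \<open>a \<in> T\<close> form a chain under inclusion, so by finiteness
  there is a largest one. It contains every element of \<open>T\<close> and hence equals \<open>T\<close>
  (\<open>monogenic_if_comparable\<close>).

  Conversely, let \<open>x\<close> and \<open>y\<close> commute. The subsemigroup that they generate is commutative, hence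
  equal to \<open>\<langle>a\<rangle>\<close> for some \<open>a\<close>. If \<open>a\<close> is not a product of two of its elements, then \<open>a\<close> is one of the
  generators \<open>x\<close> and \<open>y\<close>, and the other one is a power of it. Otherwise \<open>a = a\<^sup>N\<^sup>+\<^sup>1\<close> with
  \<open>N \<ge> 1\<close>, so \<open>\<langle>a\<rangle>\<close> is a cyclic group (\<open>cyclic_subgroup_powers\<close>). Its order is a
  prime power, and in a cyclic group of prime power order the cyclic subgroups form a chain.
\<close>

section \<open>Prime powers and linear congruences\<close>

lemma two_prime_divisors:
  fixes n :: nat
  assumes "n > 0" "\<not> prime_power n"
  obtains p q where "prime p" "prime q" "p \<noteq> q" "p dvd n" "q dvd n"
proof -
  have "n \<noteq> 1"
  proof
    assume "n = 1"
    then have "n = 2 ^ 0" by simp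
    then show False
      using assms(2) two_is_prime_nat unfolding prime_power_def by blast
  qed
  then obtain p where p: "prime p" "p dvd n"
    using prime_factor_nat by blast
  obtain m where m: "n = p ^ multiplicity p n * m" "\<not> p dvd m"
    using multiplicity_decompose'[of n p] assms(1) p(1) by (metis not_prime_unit neq0_conv)
  have "m \<noteq> 1"
    using m(1) p(1) assms(2) unfolding prime_power_def by (metis mult.right_neutral)
  then obtain q where q: "prime q" "q dvd m"
    using prime_factor_nat by blast
  have "q dvd n"
    by (subst m(1)) (simp add: q(2))
  moreover have "p \<noteq> q"
    using q(2) m(2) by blast
  ultimately show thesis
    using that p q(1) by blast
qed

lemma cong_mult_positive_solution:
  fixes s t n :: nat
  assumes "n > 0" "gcd s n dvd t"
  shows "\<exists>k\<ge>1. [s * k = t] (mod n)"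
proof -
  obtain x where "[s * x = t] (mod n)"
    using cong_solve_dvd_nat[OF assms(2)] by blast
  \<comment> \<open>The solution may be \<open>0\<close>; adding the modulus makes it positive.\<close>
  then have "[s * (x + n) = t] (mod n)"
    by (simp add: cong_def distrib_left)
  then show ?thesis
    using assms(1) by (intro exI[of _ "x + n"]) simp
qed

text \<open>
  The cyclic subgroups of \<open>\<int>/n\<close> form a chain when \<open>n\<close> is a prime power: the subgroups generated by
  \<open>s\<close> and \<open>t\<close> are determined by \<open>gcd(s, n)\<close> and \<open>gcd(t, n)\<close>, which are powers of the same prime, so
  one divides the other.
\<close>

lemma prime_power_cong_chain:
  assumes "prime_power n"
  shows "\<exists>k\<ge>1. [s * k = t] (mod n) \<or> [t * k = s] (mod n)"
proof -
  obtain p m where p: "prime p" "n = p ^ m"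
    using assms unfolding prime_power_def by blast
  then have "n > 0"
    by (simp add: prime_gt_0_nat)
  obtain i where i: "gcd s n = p ^ i"
    using divides_primepow_nat[of p "gcd s n" m] p by auto
  obtain j where j: "gcd t n = p ^ j"
    using divides_primepow_nat[of p "gcd t n" m] p by auto
  have "gcd s n dvd gcd t n \<or> gcd t n dvd gcd s n"
    using i j by (metis le_imp_power_dvd linear)
  then have "gcd s n dvd t \<or> gcd t n dvd s"
    by auto
  then show ?thesis
    using cong_mult_positive_solution[OF \<open>n > 0\<close>] by blast
qed

section \<open>Powers in a semigroup\<close>

context semigroup_on
begin

abbreviation pow (infixr \<open>\<up>\<close> 80) where
  "a \<up> k \<equiv> sg_pow (\<cdot>) a k"

abbreviation powers where
  "powers a \<equiv> {a \<up> k | k. k \<ge> 1}"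

lemma pow_1 [simp]: "a \<up> Suc 0 = a"
  by (simp add: sg_pow_def)

lemma self_in_powers: "a \<in> powers a"
  by (auto intro!: exI[of _ "Suc 0"])

lemma pow_Suc: "k \<ge> 1 \<Longrightarrow> a \<up> Suc k = a \<cdot> a \<up> k"
  by (cases k) (auto simp: sg_pow_def)

lemma pow_closed:
  assumes "a \<in> S" "k \<ge> 1"
  shows "a \<up> k \<in> S"
  using assms(2) by (induction k rule: dec_induct) (auto simp: pow_Suc closed assms(1))

lemma pow_add:
  assumes "a \<in> S" "m \<ge> 1" "n \<ge> 1"
  shows "a \<up> (m + n) = a \<up> m \<cdot> a \<up> n"
  using assms(2)
proof (induction m rule: dec_induct)
  case base
  then show ?case using assms by (simp add: pow_Suc)
next
  case (step m)
  then show ?case using assms by (simp add: pow_Suc assoc pow_closed)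
qed

lemma pow_mult:
  assumes "a \<in> S" "m \<ge> 1" "n \<ge> 1"
  shows "a \<up> (m * n) = (a \<up> m) \<up> n"
  using assms(3)
proof (induction n rule: dec_induct)
  case base
  then show ?case by simp
next
  case (step n)
  then show ?case using assms by (simp add: pow_Suc pow_add)
qed

lemma pow_commute:
  assumes "a \<in> S" "k \<ge> 1"
  shows "a \<cdot> a \<up> k = a \<up> k \<cdot> a"
  using pow_add[of a 1 k] pow_add[of a k 1] assms by (simp add: add.commute)

lemma powers_subset:
  assumes "a \<in> S" "b \<in> powers a"
  shows "powers b \<subseteq> powers a"
proof
  fix c assume "c \<in> powers b"
  then obtain m n where "m \<ge> 1" "n \<ge> 1" "b = a \<up> m" "c = b \<up> n"
    using assms(2) by auto
  then have "c = a \<up> (m * n)" "m * n \<ge> 1"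
    using assms(1) by (simp_all add: pow_mult)
  then show "c \<in> powers a" by blast
qed

lemma subsemigroup_pow_closed:
  assumes "subsemigroup T S (\<cdot>)" "a \<in> T" "k \<ge> 1"
  shows "a \<up> k \<in> T"
  using assms semigroup_on.pow_closed unfolding subsemigroup_def by metis

lemma subsemigroup_powers:
  assumes "a \<in> S"
  shows "subsemigroup (powers a) S (\<cdot>)"
  unfolding subsemigroup_def
proof
  show "powers a \<subseteq> S"
    using assms pow_closed by auto
  show "semigroup_on (powers a) (\<cdot>)"
  proof
    show "powers a \<noteq> {}" by auto
  next
    fix x y assume "x \<in> powers a" "y \<in> powers a"
    then obtain m n where "m \<ge> 1" "n \<ge> 1" "x = a \<up> m" "y = a \<up> n"
      by auto
    then have "x \<cdot> y = a \<up> (m + n)" "m + n \<ge> 1"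
      using assms by (simp_all add: pow_add)
    then show "x \<cdot> y \<in> powers a" by blast
  next
    fix x y z assume "x \<in> powers a" "y \<in> powers a" "z \<in> powers a"
    then show "(x \<cdot> y) \<cdot> z = x \<cdot> (y \<cdot> z)"
      using assms pow_closed by (intro assoc) auto
  qed
qed

section \<open>Equality of the two graphs\<close>

lemma graphs_equal_iff:
  "power_graph S (\<cdot>) = commuting_graph S (\<cdot>) \<longleftrightarrow>
    (\<forall>x\<in>S. \<forall>y\<in>S. x \<cdot> y = y \<cdot> x \<longrightarrow> x \<in> powers y \<or> y \<in> powers x)"
    (is "_ \<longleftrightarrow> ?C")
proof -
  have comm: "x \<cdot> y = y \<cdot> x" if "x \<in> S" "y \<in> S" "x \<in> powers y \<or> y \<in> powers x" for x y
    using that pow_commute by auto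
  have "power_graph S (\<cdot>) = commuting_graph S (\<cdot>) \<longleftrightarrow>
    (\<forall>x y. (x \<in> S \<and> y \<in> S \<and> x \<noteq> y \<and> (\<exists>k\<ge>1. x = y \<up> k \<or> y = x \<up> k)) \<longleftrightarrow>
           (x \<in> S \<and> y \<in> S \<and> x \<noteq> y \<and> x \<cdot> y = y \<cdot> x))"
    unfolding power_graph_def commuting_graph_def by (simp add: set_eq_iff)
  also have "\<dots> \<longleftrightarrow> (\<forall>x\<in>S. \<forall>y\<in>S. x \<noteq> y \<longrightarrow>
      ((x \<in> powers y \<or> y \<in> powers x) \<longleftrightarrow> x \<cdot> y = y \<cdot> x))"
  proof -
    have "(\<exists>k\<ge>1. x = y \<up> k \<or> y = x \<up> k) \<longleftrightarrow> x \<in> powers y \<or> y \<in> powers x" for x y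
      by blast
    moreover have "((A \<and> B \<and> D \<and> P) \<longleftrightarrow> (A \<and> B \<and> D \<and> Q)) \<longleftrightarrow> (A \<longrightarrow> B \<longrightarrow> D \<longrightarrow> (P \<longleftrightarrow> Q))"
      for A B D P Q
      by argo
    ultimately show ?thesis
      by (simp only: Ball_def all_simps)
  qed
  also have "\<dots> \<longleftrightarrow> ?C"
  proof (intro ball_cong refl)
    fix x y assume "x \<in> S" "y \<in> S"
    then show "(x \<noteq> y \<longrightarrow> ((x \<in> powers y \<or> y \<in> powers x) \<longleftrightarrow> x \<cdot> y = y \<cdot> x)) \<longleftrightarrow>
        (x \<cdot> y = y \<cdot> x \<longrightarrow> x \<in> powers y \<or> y \<in> powers x)"
      using comm[of x y] self_in_powers[of x] by (cases "x = y") (simp, argo)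
  qed
  finally show ?thesis .
qed

section \<open>Cyclic subgroups\<close>

abbreviation monoid_on :: "'a set \<Rightarrow> 'a \<Rightarrow> 'a monoid" where
  "monoid_on H e \<equiv> \<lparr>carrier = H, monoid.mult = (\<cdot>), one = e\<rparr>"

lemma group_pow_eq_pow:
  assumes "group (monoid_on H e)" and "a \<in> H" "k \<ge> 1"
  shows "a [^]\<^bsub>monoid_on H e\<^esub> k = a \<up> k"
  using assms(3)
proof (induction k rule: dec_induct)
  case base
  interpret group "monoid_on H e" by fact
  have "a [^]\<^bsub>monoid_on H e\<^esub> (1 :: nat) = a"
    using nat_pow_eone[of a] assms(2) by simp
  then show ?case by simp
next
  case (step k)
  interpret group "monoid_on H e" by fact
  have "a [^]\<^bsub>monoid_on H e\<^esub> Suc k = a \<cdot> a [^]\<^bsub>monoid_on H e\<^esub> k"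
    using nat_pow_Suc2[of a k] assms(2) by simp
  then show ?case
    using step by (simp add: pow_Suc)
qed

text \<open>
  The elements \<open>g\<^sup>p\<close> and \<open>g\<^sup>q\<close> separate two prime divisors \<open>p \<noteq> q\<close> of the order of \<open>g\<close>:
  \<open>g\<^sup>p = g\<^sup>q\<^sup>k\<close> would make the order divide \<open>p - q k\<close>, and then \<open>q\<close> would divide \<open>p\<close>.
\<close>

lemma cyclic_subgroup_order:
  assumes "finite S"
    and comparable: "\<And>x y. \<lbrakk>x \<in> S; y \<in> S; x \<cdot> y = y \<cdot> x\<rbrakk> \<Longrightarrow> x \<in> powers y \<or> y \<in> powers x"
    and H: "cyclic_subgroup H S (\<cdot>)"
  shows "prime_power (card H)"
proof (rule ccontr)
  assume not_pp: "\<not> prime_power (card H)"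
  obtain e where grp: "group (monoid_on H e)"
    and cyc: "cyclic_group (monoid_on H e)"
    and sub: "subsemigroup H S (\<cdot>)"
    using H unfolding cyclic_subgroup_def by blast
  then have "H \<subseteq> S"
    unfolding subsemigroup_def by simp
  let ?G = "monoid_on H e"
  interpret group ?G by fact
  obtain g where g: "g \<in> H" "H = range (\<lambda>n::int. g [^]\<^bsub>?G\<^esub> n)"
    using cyc cyclic_group by auto
  have "generate ?G {g} = H"
    using generate_pow[of g] g by auto
  then have ord: "ord g = card H"
    using generate_pow_card[of g] g(1) by simp
  have "card H > 0"
    using g(1) \<open>H \<subseteq> S\<close> \<open>finite S\<close> by (metis card_gt_0_iff empty_iff finite_subset)
  then obtain p q where pq: "prime p" "prime q" "p \<noteq> q" "p dvd card H" "q dvd card H"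
    using two_prime_divisors not_pp by metis
  have "g \<in> S" "p \<ge> 1" "q \<ge> 1"
    using g(1) \<open>H \<subseteq> S\<close> prime_ge_1_nat[OF pq(1)] prime_ge_1_nat[OF pq(2)] by auto
  have separated: False
    if "prime p'" "prime q'" "p' \<noteq> q'" "q' dvd card H"
      and pow: "g \<up> p' \<in> powers (g \<up> q')" for p' q'
  proof -
    have ge: "p' \<ge> 1" "q' \<ge> 1"
      using that(1,2) prime_ge_1_nat by blast+
    obtain k where k: "k \<ge> 1" "g \<up> p' = (g \<up> q') \<up> k"
      using pow by auto
    have "g \<up> p' = g \<up> (q' * k)"
      using k ge \<open>g \<in> S\<close> by (simp add: pow_mult)
    then have "g [^]\<^bsub>?G\<^esub> int p' = g [^]\<^bsub>?G\<^esub> int (q' * k)"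
      using group_pow_eq_pow[OF grp g(1)] ge k(1) by (simp add: int_pow_int del: of_nat_mult)
    then have "int (card H) dvd int (q' * k) - int p'"
      using int_pow_eq[of g "int p'" "int (q' * k)"] g(1) ord by simp
    then have "int q' dvd int (q' * k) - int p'"
      using that(4) by (meson dvd_trans of_nat_dvd_iff)
    then have "q' dvd p'"
      by (metis dvd_diff_right_iff dvd_triv_left of_nat_dvd_iff of_nat_mult)
    then show False
      using that(1-3) primes_dvd_imp_eq by blast
  qed
  have "g \<up> p \<cdot> g \<up> q = g \<up> q \<cdot> g \<up> p"
    using pow_add \<open>g \<in> S\<close> \<open>p \<ge> 1\<close> \<open>q \<ge> 1\<close> by (metis add.commute)
  then have "g \<up> p \<in> powers (g \<up> q) \<or> g \<up> q \<in> powers (g \<up> p)"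
    using comparable pow_closed \<open>g \<in> S\<close> \<open>p \<ge> 1\<close> \<open>q \<ge> 1\<close> by blast
  then show False
    using separated[OF pq(1,2,3,5)] separated[OF pq(2,1) pq(3)[symmetric] pq(4)] by blast
qed

lemma pow_add_period:
  assumes "a \<in> S" "a \<up> Suc n = a" "m \<ge> 1"
  shows "a \<up> (m + c * n) = a \<up> m"
proof (induction c)
  case 0
  then show ?case by simp
next
  case (Suc c)
  have shift: "a \<up> (l + n) = a \<up> l" if "l \<ge> 1" for l
  proof (cases "l = 1")
    case True
    then show ?thesis using assms(2) by simp
  next
    case False
    then have "a \<up> (l + n) = a \<up> (l - 1) \<cdot> a \<up> Suc n"
      using pow_add[of a "l - 1" "Suc n"] that assms(1) by simp
    also have "\<dots> = a \<up> l"
      using pow_add[of a "l - 1" 1] that False assms by simp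
    finally show ?thesis .
  qed
  have "a \<up> (m + Suc c * n) = a \<up> ((m + c * n) + n)"
    by (simp add: algebra_simps)
  then show ?case
    using shift[of "m + c * n"] Suc assms(3) by simp
qed

lemma pow_eq_if_cong:
  assumes "a \<in> S" "a \<up> Suc n = a" "u \<ge> 1" "v \<ge> 1" "[u = v] (mod n)"
  shows "a \<up> u = a \<up> v"
  using assms pow_add_period[of a n] unfolding cong_iff_lin_nat by metis

text \<open>
  If the powers of \<open>a\<close> are purely periodic with period \<open>n\<close>, then \<open>a\<^sup>n\<close> is an identity for them, and
  \<open>a\<^sup>k\<close> is inverted by a power whose exponent is congruent to \<open>-k\<close> modulo \<open>n\<close>.
\<close>

lemma cyclic_subgroup_powers:
  assumes a: "a \<in> S" and n: "n \<ge> 1" and period: "a \<up> Suc n = a"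
  shows "cyclic_subgroup (powers a) S (\<cdot>)"
proof -
  let ?G = "monoid_on (powers a) (a \<up> n)"
  note sub = subsemigroup_powers[OF a]
  then have P: "semigroup_on (powers a) (\<cdot>)"
    unfolding subsemigroup_def by simp
  have grp: "group ?G"
  proof (rule groupI; simp only: monoid.simps partial_object.simps)
    show "x \<cdot> y \<in> powers a" if "x \<in> powers a" "y \<in> powers a" for x y
      using that semigroup_on.closed[OF P] by blast
    show "a \<up> n \<in> powers a"
      using n by blast
    show "(x \<cdot> y) \<cdot> z = x \<cdot> (y \<cdot> z)"
      if "x \<in> powers a" "y \<in> powers a" "z \<in> powers a" for x y z
      using that semigroup_on.assoc[OF P] by blast
  next
    fix x assume "x \<in> powers a"
    then obtain k where k: "k \<ge> 1" "x = a \<up> k" by auto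
    have "a \<up> n \<cdot> a \<up> k = a \<up> (k + 1 * n)"
      using pow_add[of a n k] a n k(1) by (simp add: add.commute)
    then show "a \<up> n \<cdot> x = x"
      using pow_add_period[OF a period k(1), of 1] k(2) by simp
    \<comment> \<open>The summand \<open>n\<close> keeps the exponent of the inverse positive when \<open>n = 1\<close>.\<close>
    define j where "j = (k * n - k) + n"
    have "j \<ge> 1" "j + k = n + k * n"
      using n mult_le_mono2[OF n, of k] unfolding j_def by linarith+
    then have "a \<up> j \<cdot> a \<up> k = a \<up> n"
      using pow_add[of a j k] pow_add_period[OF a period n, of k] a k(1) by simp
    then show "\<exists>y\<in>powers a. y \<cdot> x = a \<up> n"
      using \<open>j \<ge> 1\<close> k(2) by blast
  qed
  then interpret G: group ?G .
  have mem: "a \<in> powers a"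
    by (rule self_in_powers)
  have "powers a \<subseteq> range (\<lambda>m::int. a [^]\<^bsub>?G\<^esub> m)"
  proof
    fix x assume "x \<in> powers a"
    then obtain k where "k \<ge> 1" "x = a \<up> k" by auto
    then have "x = a [^]\<^bsub>?G\<^esub> int k"
      using group_pow_eq_pow[OF grp mem] by (simp add: int_pow_int)
    then show "x \<in> range (\<lambda>m::int. a [^]\<^bsub>?G\<^esub> m)" by blast
  qed
  moreover have "range (\<lambda>m::int. a [^]\<^bsub>?G\<^esub> m) \<subseteq> powers a"
    using G.int_pow_closed[of a] mem by auto
  ultimately have "powers a = range (\<lambda>m::int. a [^]\<^bsub>?G\<^esub> m)"
    by (rule subset_antisym)
  then have "\<exists>x\<in>carrier ?G. carrier ?G = range (\<lambda>m::int. x [^]\<^bsub>?G\<^esub> m)"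
    using mem by (simp only: partial_object.select_convs) (rule bexI)
  then have "cyclic_group ?G"
    by (simp only: G.cyclic_group)
  then show ?thesis
    using grp sub unfolding cyclic_subgroup_def by blast
qed

text \<open>
  By Lagrange, the order of a cyclic subgroup \<open>\<langle>a\<rangle>\<close> is a period of the powers of \<open>a\<close>, so
  the exponents of two elements can be compared modulo that order.
\<close>

lemma cyclic_prime_power_comparable:
  assumes a: "a \<in> S" and H: "cyclic_subgroup (powers a) S (\<cdot>)"
    and pp: "prime_power (card (powers a))"
    and "x \<in> powers a" "y \<in> powers a"
  shows "x \<in> powers y \<or> y \<in> powers x"
proof -
  define n where "n = card (powers a)"
  obtain e where grp: "group (monoid_on (powers a) e)"
    using H unfolding cyclic_subgroup_def by blast
  let ?G = "monoid_on (powers a) e"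
  interpret group ?G by fact
  have mem: "a \<in> powers a"
    by (rule self_in_powers)
  have "a [^]\<^bsub>?G\<^esub> n = e"
    using pow_order_eq_1[of a] mem by (simp add: order_def n_def)
  then have "a [^]\<^bsub>?G\<^esub> Suc n = a"
    using nat_pow_Suc[of a n] l_one[of a] mem by simp
  then have period: "a \<up> Suc n = a"
    using group_pow_eq_pow[OF grp mem, of "Suc n"] by simp
  obtain s t where st: "s \<ge> 1" "t \<ge> 1" "x = a \<up> s" "y = a \<up> t"
    using assms(4,5) by auto
  have eq: "(a \<up> u) \<up> k = a \<up> v" if "u \<ge> 1" "v \<ge> 1" "k \<ge> 1" "[u * k = v] (mod n)" for u v k
    using pow_eq_if_cong[OF a period, of "u * k" v] pow_mult[OF a, of u k] that by simp
  obtain k where "k \<ge> 1" "[s * k = t] (mod n) \<or> [t * k = s] (mod n)"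
    using prime_power_cong_chain pp n_def by blast
  then have "k \<ge> 1" "x \<up> k = y \<or> y \<up> k = x"
    using eq st by auto
  then show ?thesis by blast
qed

section \<open>Commutative subsemigroups\<close>

text \<open>
  An element with the largest number of powers generates: its set of powers lies in no
  strictly larger set of this kind, whereas any two such sets are comparable.
\<close>

lemma monogenic_if_comparable:
  assumes "finite S"
    and comparable: "\<And>x y. \<lbrakk>x \<in> S; y \<in> S; x \<cdot> y = y \<cdot> x\<rbrakk> \<Longrightarrow> x \<in> powers y \<or> y \<in> powers x"
    and T: "subsemigroup T S (\<cdot>)" and comm: "commutative_on T (\<cdot>)"
  shows "monogenic T (\<cdot>)"
proof -
  have "T \<subseteq> S" "T \<noteq> {}"
    using T unfolding subsemigroup_def semigroup_on_def by simp_all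
  then have "finite T"
    using assms(1) finite_subset by blast
  obtain a where "a \<in> T" and a: "card (powers a) = Max ((\<lambda>b. card (powers b)) ` T)"
    by (rule obtains_MAX[OF \<open>finite T\<close> \<open>T \<noteq> {}\<close>, of "\<lambda>b. card (powers b)"]) (rule that, simp_all)
  have max: "card (powers b) \<le> card (powers a)" if "b \<in> T" for b
    unfolding a using \<open>finite T\<close> that by (intro Max_ge) auto
  have "T \<subseteq> powers a"
  proof
    fix x assume "x \<in> T"
    have xa: "x \<in> S" "a \<in> S"
      using \<open>x \<in> T\<close> \<open>a \<in> T\<close> \<open>T \<subseteq> S\<close> by auto
    have mem: "x \<in> powers x"
      by (rule self_in_powers)
    have "x \<cdot> a = a \<cdot> x"
      using comm \<open>x \<in> T\<close> \<open>a \<in> T\<close> unfolding commutative_on_def by simp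
    then consider "x \<in> powers a" | "a \<in> powers x"
      using comparable xa by blast
    then show "x \<in> powers a"
    proof cases
      case 2
      then have "powers a \<subseteq> powers x"
        using powers_subset xa by simp
      moreover have "finite (powers x)"
        using subsemigroup_powers[OF xa(1)] assms(1) unfolding subsemigroup_def
        by (meson finite_subset)
      ultimately have "powers a = powers x"
        using max[OF \<open>x \<in> T\<close>] card_seteq by blast
      then show ?thesis
        using mem by simp
    qed
  qed
  moreover have "powers a \<subseteq> T"
    using subsemigroup_pow_closed[OF T \<open>a \<in> T\<close>] by auto
  ultimately show ?thesis
    using \<open>a \<in> T\<close> unfolding monogenic_def by blast
qed

text \<open>
  The inductive form yields the case distinction needed below: an element of the generated
  subsemigroup is a generator or a product of two elements of that subsemigroup.
\<close>

inductive_set generated :: "'a set \<Rightarrow> 'a set" for A where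
  base: "a \<in> A \<Longrightarrow> a \<in> generated A"
| mult: "\<lbrakk>x \<in> generated A; y \<in> generated A\<rbrakk> \<Longrightarrow> x \<cdot> y \<in> generated A"

lemma generated_subset:
  assumes "A \<subseteq> S"
  shows "generated A \<subseteq> S"
proof
  fix x assume "x \<in> generated A"
  then show "x \<in> S"
    by induction (use assms closed in auto)
qed

lemma subsemigroup_generated:
  assumes "A \<subseteq> S" "A \<noteq> {}"
  shows "subsemigroup (generated A) S (\<cdot>)"
proof -
  note sub = generated_subset[OF assms(1)]
  have "semigroup_on (generated A) (\<cdot>)"
  proof
    show "generated A \<noteq> {}"
      using assms(2) generated.base by blast
  next
    fix x y z assume "x \<in> generated A" "y \<in> generated A" "z \<in> generated A"
    then show "(x \<cdot> y) \<cdot> z = x \<cdot> (y \<cdot> z)"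
      using sub by (intro assoc) auto
  qed (rule generated.mult)
  with sub show ?thesis
    unfolding subsemigroup_def by simp
qed

lemma commutes_mult:
  assumes "x \<in> S" "y \<in> S" "c \<in> S" "x \<cdot> c = c \<cdot> x" "y \<cdot> c = c \<cdot> y"
  shows "(x \<cdot> y) \<cdot> c = c \<cdot> (x \<cdot> y)"
  using assms assoc by metis

lemma commutative_on_generated:
  assumes A: "A \<subseteq> S" and comm: "commutative_on A (\<cdot>)"
  shows "commutative_on (generated A) (\<cdot>)"
proof -
  have sub: "z \<in> S" if "z \<in> generated A" for z
    using that generated_subset[OF A] by blast
  have gen: "x \<cdot> c = c \<cdot> x" if "x \<in> generated A" "c \<in> A" for x c
    using that
  proof induction
    case (base a)
    then show ?case using comm unfolding commutative_on_def by simp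
  next
    case (mult x y)
    then show ?case using sub A by (intro commutes_mult) auto
  qed
  have "y \<cdot> x = x \<cdot> y" if "y \<in> generated A" "x \<in> generated A" for x y
    using that
  proof induction
    case (base a)
    then show ?case using gen by simp
  next
    case (mult y z)
    then show ?case using sub by (intro commutes_mult) auto
  qed
  then show ?thesis
    unfolding commutative_on_def by blast
qed

text \<open>
  Either the generator \<open>a\<close> of the subsemigroup generated by \<open>x\<close> and \<open>y\<close> is one of \<open>x\<close>, \<open>y\<close>, or it is
  a product \<open>a\<^sup>i a\<^sup>j\<close>; in the second case the powers of \<open>a\<close> have period \<open>i + j - 1\<close> and form a cyclic
  group of prime power order.
\<close>

lemma comparable_if_monogenic:
  assumes orders: "\<And>H. cyclic_subgroup H S (\<cdot>) \<Longrightarrow> prime_power (card H)"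
    and monogenic: "\<And>T. \<lbrakk>subsemigroup T S (\<cdot>); commutative_on T (\<cdot>)\<rbrakk> \<Longrightarrow> monogenic T (\<cdot>)"
    and xy: "x \<in> S" "y \<in> S" "x \<cdot> y = y \<cdot> x"
  shows "x \<in> powers y \<or> y \<in> powers x"
proof -
  let ?T = "generated {x, y}"
  have "commutative_on {x, y} (\<cdot>)"
    using xy(3) unfolding commutative_on_def by simp
  then have "monogenic ?T (\<cdot>)"
    using xy by (intro monogenic subsemigroup_generated commutative_on_generated) auto
  then obtain a where "a \<in> ?T" and T: "?T = powers a"
    unfolding monogenic_def by blast
  then have "a \<in> S"
    using generated_subset[of "{x, y}"] xy by blast
  have xy_powers: "x \<in> powers a" "y \<in> powers a"
    unfolding T[symmetric] by (auto intro: generated.base)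
  show ?thesis
    using \<open>a \<in> ?T\<close>
  proof cases
    case base
    then show ?thesis
      using xy_powers by blast
  next
    case (mult u v)
    then have "u \<in> powers a" "v \<in> powers a"
      using T by simp_all
    then obtain i j where ij: "i \<ge> 1" "j \<ge> 1" "u = a \<up> i" "v = a \<up> j"
      by auto
    then have "a \<up> (i + j) = u \<cdot> v"
      using pow_add[OF \<open>a \<in> S\<close>, of i j] by simp
    also note mult(1)[symmetric]
    finally have "a \<up> Suc (i + j - 1) = a" and "i + j - 1 \<ge> 1"
      using ij(1,2) by simp_all
    then have "cyclic_subgroup (powers a) S (\<cdot>)"
      using cyclic_subgroup_powers \<open>a \<in> S\<close> by blast
    then show ?thesis
      using cyclic_prime_power_comparable \<open>a \<in> S\<close> orders xy_powers by blast
  qed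
qed

end

section \<open>The characterization\<close>

theorem theorem4p19:
  fixes S :: "'a set" and mul :: "'a \<Rightarrow> 'a \<Rightarrow> 'a"
  assumes "semigroup_on S mul" and "finite S"
  shows "power_graph S mul = commuting_graph S mul \<longleftrightarrow>
    (\<forall>H. cyclic_subgroup H S mul \<longrightarrow> prime_power (card H)) \<and>
    (\<forall>T. subsemigroup T S mul \<and> commutative_on T mul \<longrightarrow> monogenic T mul)"
proof -
  interpret semigroup_on S mul by fact
  show ?thesis
    unfolding graphs_equal_iff
  proof (intro iffI conjI allI impI ballI)
    assume *: "\<forall>x\<in>S. \<forall>y\<in>S. mul x y = mul y x \<longrightarrow> x \<in> powers y \<or> y \<in> powers x"
    show "prime_power (card H)" if "cyclic_subgroup H S mul" for H
      using cyclic_subgroup_order[OF \<open>finite S\<close> _ that] * by blast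
    show "monogenic T mul" if "subsemigroup T S mul \<and> commutative_on T mul" for T
      using monogenic_if_comparable[OF \<open>finite S\<close>, of T] that * by blast
  next
    fix x y
    assume "(\<forall>H. cyclic_subgroup H S mul \<longrightarrow> prime_power (card H)) \<and>
        (\<forall>T. subsemigroup T S mul \<and> commutative_on T mul \<longrightarrow> monogenic T mul)"
      and "x \<in> S" "y \<in> S" "mul x y = mul y x"
    then show "x \<in> powers y \<or> y \<in> powers x"
      using comparable_if_monogenic by blast
  qed
qed

end
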